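(* Let $A\in DN(n,r)$ and let $A=B^TB$ where $B\in\mathbb{R}^{r\times n}$ has rank $r$. (i) If $r=3$ and $B$ is nnq, then $A\in CP(n,3)$. (ii) If $r=4$ and $B$ is nnq, then $A\in CP(n,4)$.
   Context: All matrices are real. An $n\times n$ matrix $A$ is doubly nonnegative if it is symmetric positive semidefinite and all its entries are nonnegative. $DN(n,r)$ is the set of all $n\times n$ doubly nonnegative matrices of rank $r$. An $n\times n$ matrix $A$ is completely positive if $A=B^TB$ for some entrywise nonnegative $B\in\mathbb{R}^{m\times n}$ (for some $m$); the minimum such $m$ is called the cp-rank of $A$. $CP(n,r)$ is the set of all $n\times n$ completely positive matrices $A$ with $\text{cp-rank}(A)=\operatorname{rank}(A)=r$. It is assumed throughout that $0<r\le n$. An $r\times n$ matrix $B$ with $r=\operatorname{rank}(B)\le n$ is called nnq (nonnegative equivalent) if there is a nonsingular $r\times r$ submatrix $B_1$ of $B$ (formed by $r$ of its columns) such that $B_1^{-1}B\ge 0$ entrywise. *)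

theory Defs
  imports Complex_Main "Jordan_Normal_Form.DL_Rank" "Jordan_Normal_Form.DL_Submatrix"
begin

text \<open>\<open>vec_space.rank m\<close> is the column rank of a matrix with \<open>m\<close> rows.\<close>

abbreviation mat_rank :: "real mat \<Rightarrow> nat" where
  "mat_rank A \<equiv> vec_space.rank (dim_row A) A"

definition entrywise_nonneg :: "real mat \<Rightarrow> bool" where
  "entrywise_nonneg A \<longleftrightarrow> (\<forall>i < dim_row A. \<forall>j < dim_col A. 0 \<le> A $$ (i, j))"

definition sym_psd :: "nat \<Rightarrow> real mat \<Rightarrow> bool" where
  "sym_psd n A \<longleftrightarrow> A \<in> carrier_mat n n \<and> A\<^sup>T = A \<and>
     (\<forall>x \<in> carrier_vec n. 0 \<le> x \<bullet> (A *\<^sub>v x))"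

definition DN :: "nat \<Rightarrow> nat \<Rightarrow> real mat set" where
  "DN n r = {A. sym_psd n A \<and> entrywise_nonneg A \<and> mat_rank A = r}"

definition cp_factorization :: "nat \<Rightarrow> nat \<Rightarrow> real mat \<Rightarrow> real mat \<Rightarrow> bool" where
  "cp_factorization m n A B \<longleftrightarrow> B \<in> carrier_mat m n \<and> entrywise_nonneg B \<and> A = B\<^sup>T * B"

definition completely_positive :: "nat \<Rightarrow> real mat \<Rightarrow> bool" where
  "completely_positive n A \<longleftrightarrow> A \<in> carrier_mat n n \<and> (\<exists>m B. cp_factorization m n A B)"

text \<open>Meaningful only for completely positive matrices; otherwise \<open>LEAST\<close> is unspecified.\<close>

definition cp_rank :: "nat \<Rightarrow> real mat \<Rightarrow> nat" where
  "cp_rank n A = (LEAST m. \<exists>B. cp_factorization m n A B)"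

definition CP :: "nat \<Rightarrow> nat \<Rightarrow> real mat set" where
  "CP n r = {A. completely_positive n A \<and> cp_rank n A = r \<and> mat_rank A = r}"

text \<open>\<open>submatrix B UNIV J\<close> keeps the columns indexed by \<open>J\<close> in increasing order. The order
  is immaterial: reordering the columns of \<open>B\<^sub>1\<close> only permutes the rows of \<open>B\<^sub>1\<inverse> B\<close>.
  In the definition, \<open>C\<close> is the inverse of \<open>B\<^sub>1\<close>.\<close>

definition nnq :: "nat \<Rightarrow> nat \<Rightarrow> real mat \<Rightarrow> bool" where
  "nnq r n B \<longleftrightarrow> B \<in> carrier_mat r n \<and> mat_rank B = r \<and> r \<le> n \<and>
     (\<exists>J \<subseteq> {..<n}. card J = r \<and>
        (let B\<^sub>1 = submatrix B UNIV J in
           \<exists>C \<in> carrier_mat r r. inverts_mat B\<^sub>1 C \<and> inverts_mat C B\<^sub>1 \<and>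
             entrywise_nonneg (C * B)))"

end

theory Submission
  imports Defs "HOL-Analysis.Euclidean_Space" "HOL-Library.Product_Order"
begin

text \<open>
  Let \<open>B\<^sub>1\<close> be the submatrix that witnesses nonnegative equivalence and \<open>D = B\<^sub>1\<inverse> B \<ge> 0\<close>, so
  that \<open>A = D\<^sup>T (B\<^sub>1\<^sup>T B\<^sub>1) D\<close>. The matrix \<open>B\<^sub>1\<^sup>T B\<^sub>1\<close> is a principal submatrix of \<open>A\<close>, hence
  nonnegative. If it equals \<open>N\<^sup>T N\<close> with \<open>N \<ge> 0\<close> of size \<open>r \<times> r\<close>, then
  \<open>A = (N D)\<^sup>T (N D)\<close> with \<open>N D \<ge> 0\<close> having \<open>r\<close> rows (\<open>CP_if_nnq\<close>). No factor has fewer than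
  \<open>rank A\<close> rows, so the cp-rank is \<open>r\<close> (\<open>CP_if_rank_many_rows\<close>).

  What remains is geometric: three or four vectors with pairwise nonnegative inner products can be
  moved by an isometry of their span into the nonnegative orthant of a space of dimension three or
  four. For four vectors (\<open>orthant_embedding_four\<close>), normalise them and let \<open>v\<^sub>3, v\<^sub>4\<close> be a pair
  enclosing the largest angle, with \<open>c\<close> its cosine. Put \<open>q = v\<^sub>4 - c v\<^sub>3\<close>, which is orthogonal
  to \<open>v\<^sub>3\<close>. For \<open>i = 1, 2\<close>, \<open>\<langle>v\<^sub>i, v\<^sub>3\<rangle> \<le> 1\<close> and minimality of \<open>c\<close> give
  \<open>\<langle>v\<^sub>i, q\<rangle> \<ge> \<langle>v\<^sub>i, v\<^sub>4\<rangle> - c \<ge> 0\<close>. Since \<open>v\<^sub>4 = q + c v\<^sub>3\<close> is a nonnegative combination, one may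
  replace \<open>v\<^sub>4\<close> by \<open>q\<close>, that is, assume that \<open>v\<^sub>3\<close> and \<open>v\<^sub>4\<close> are orthogonal.

  In that case (\<open>orthant_embedding_orthogonal_pair\<close>) split the space into two orthogonal planes,
  one through \<open>v\<^sub>3\<close> and one through \<open>v\<^sub>4\<close>, in such a way that the projections of \<open>v\<^sub>1\<close> and
  \<open>v\<^sub>2\<close> to each plane have nonnegative inner product. The freedom is a rotation in the complement of
  \<open>v\<^sub>3, v\<^sub>4\<close>, and the intermediate value theorem finds it (\<open>split_inner_product\<close>). In each plane
  three vectors with pairwise nonnegative inner products fit into a quadrant
  (\<open>planar_quadrant\<close>). Three vectors reduce to four by adding a vector orthogonal to them.
\<close>

section \<open>Vectors with pairwise nonnegative inner products\<close>

text \<open>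
  The unit vector \<open>(1, 0)\<close> and the vectors \<open>(a, x)\<close>, \<open>(b, y)\<close> have pairwise nonnegative
  inner products, so they span a sector of at most a right angle, and a rotation or reflection takes
  this sector into the quadrant. The images of the three vectors are \<open>e\<close>, \<open>u\<close> and \<open>v\<close>.
\<close>

lemma planar_quadrant:
  fixes a b x y :: real
  assumes "0 \<le> a" "0 \<le> b" "0 \<le> a * b + x * y"
  obtains e u v :: "real \<times> real"
  where "0 \<le> e" "0 \<le> u" "0 \<le> v"
    and "inner e e = 1" "inner u e = a" "inner v e = b"
    and "inner u u = a\<^sup>2 + x\<^sup>2" "inner v v = b\<^sup>2 + y\<^sup>2" "inner u v = a * b + x * y"
proof (cases "0 \<le> x * y")
  case True
  (* Both vectors lie on the same side of the first axis: reflect if necessary. *)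
  show ?thesis
  proof (rule that[of "(1, 0)" "(a, \<bar>x\<bar>)" "(b, \<bar>y\<bar>)"])
    show "inner (a, \<bar>x\<bar>) (b, \<bar>y\<bar>) = a * b + x * y"
      using True by (simp add: abs_mult[symmetric])
  qed (use assms in \<open>auto simp: less_eq_prod_def power2_eq_square\<close>)
next
  case False
  (* The first axis separates the two vectors, so (a, x) is an extreme ray of the sector: turn it
     into the first axis. The second coordinate is then the absolute value of a determinant. *)
  define r where "r = sqrt (a\<^sup>2 + x\<^sup>2)"
  have "x \<noteq> 0" using False by auto
  then have "0 < a\<^sup>2 + x\<^sup>2" by (simp add: add_nonneg_pos)
  then have r: "r > 0" "r * r = a * a + x * x"
    by (auto simp: r_def power2_eq_square)
  define X Y where "X = \<bar>x\<bar>" and "Y = \<bar>y\<bar>"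
  have XY: "0 \<le> X" "0 \<le> Y" "X * X = x * x" "Y * Y = y * y" "x * y = - (X * Y)"
    using False by (simp_all add: X_def Y_def abs_mult[symmetric])
  have rX: "r * r = a * a + X * X" using r XY by simp
  show ?thesis
  proof (rule that[of "(a / r, X / r)" "(r, 0)" "((a * b + x * y) / r, (a * Y + b * X) / r)"])
    have "inner (a / r, X / r) (a / r, X / r) = (a * a + X * X) / (r * r)"
      by (simp add: add_divide_distrib)
    then show "inner (a / r, X / r) (a / r, X / r) = 1"
      using rX r(1) by (metis divide_self mult_eq_0_iff less_irrefl)
    have "a * (a * b - X * Y) + X * (a * Y + b * X) = b * (r * r)"
      unfolding rX by (simp add: algebra_simps)
    moreover have "inner ((a * b + x * y) / r, (a * Y + b * X) / r) (a / r, X / r)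
      = (a * (a * b - X * Y) + X * (a * Y + b * X)) / (r * r)"
      using XY(5) by (simp add: add_divide_distrib[symmetric] mult.commute)
    ultimately show "inner ((a * b + x * y) / r, (a * Y + b * X) / r) (a / r, X / r) = b"
      using r(1) by simp
    have "(a * b - X * Y) * (a * b - X * Y) + (a * Y + b * X) * (a * Y + b * X)
      = (b * b + Y * Y) * (r * r)"
      unfolding rX by (simp add: algebra_simps)
    moreover have "inner ((a * b + x * y) / r, (a * Y + b * X) / r) ((a * b + x * y) / r, (a * Y + b * X) / r)
      = ((a * b - X * Y) * (a * b - X * Y) + (a * Y + b * X) * (a * Y + b * X)) / (r * r)"
      using XY(5) by (simp add: add_divide_distrib[symmetric])
    ultimately show "inner ((a * b + x * y) / r, (a * Y + b * X) / r) ((a * b + x * y) / r, (a * Y + b * X) / r)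
      = b\<^sup>2 + y\<^sup>2"
      using r(1) XY(4) by (simp add: power2_eq_square)
  qed (use assms r XY in \<open>auto simp: less_eq_prod_def power2_eq_square\<close>)
qed

text \<open>
  Choosing orthonormal coordinates in the plane of \<open>u\<close> and \<open>v\<close> splits \<open>inner u v\<close> into two
  summands \<open>x y\<close> and \<open>x' y'\<close>. As the axes turn by a right angle, the first summand moves
  continuously from \<open>inner u v\<close> to \<open>0\<close>. If \<open>- p \<le> inner u v\<close> the starting position is good
  enough; otherwise \<open>x y\<close> takes the value \<open>- p\<close> on the way, and then
  \<open>q + x' y' = p + q + inner u v \<ge> 0\<close>.
\<close>

lemma split_inner_product:
  fixes u v :: "'a::real_inner" and p q :: real
  assumes "0 \<le> p" "0 \<le> q" "0 \<le> p + q + inner u v"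
  obtains x y x' y' :: real
  where "x\<^sup>2 + x'\<^sup>2 = inner u u" "y\<^sup>2 + y'\<^sup>2 = inner v v" "x * y + x' * y' = inner u v"
    and "0 \<le> p + x * y" "0 \<le> q + x' * y'"
proof -
  (* Coordinates in which u = (\<alpha>, 0) and v = (\<beta>, \<gamma>). If u = 0, division by zero gives \<beta> = 0. *)
  define \<alpha> \<beta> \<gamma> where "\<alpha> = norm u" and "\<beta> = inner u v / norm u"
    and "\<gamma> = sqrt (inner v v - \<beta>\<^sup>2)"
  have \<alpha>: "\<alpha>\<^sup>2 = inner u u" by (simp add: \<alpha>_def power2_norm_eq_inner)
  have \<alpha>\<beta>: "\<alpha> * \<beta> = inner u v" by (cases "u = 0") (auto simp: \<alpha>_def \<beta>_def)
  have "\<beta>\<^sup>2 \<le> inner v v"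
  proof (cases "u = 0")
    case False
    have "(inner u v)\<^sup>2 \<le> inner u u * inner v v" by (rule Cauchy_Schwarz_ineq)
    then show ?thesis using False
      by (simp add: \<beta>_def power_divide power2_norm_eq_inner field_simps)
  qed (simp add: \<beta>_def)
  then have \<gamma>: "\<beta>\<^sup>2 + \<gamma>\<^sup>2 = inner v v" by (simp add: \<gamma>_def)
  show ?thesis
  proof (cases "- p \<le> inner u v")
    case True
    then show ?thesis
      using assms \<alpha> \<alpha>\<beta> \<gamma> by (intro that[of \<alpha> 0 \<beta> \<gamma>]) auto
  next
    case False
    define f where "f = (\<lambda>t. \<alpha> * cos t * (\<beta> * cos t + \<gamma> * sin t))"
    have "\<exists>t. 0 \<le> t \<and> t \<le> pi / 2 \<and> f t = - p"
    proof (rule IVT')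
      show "f 0 \<le> - p" using False \<alpha>\<beta> by (simp add: f_def)
      show "- p \<le> f (pi / 2)" using assms by (simp add: f_def)
      show "continuous_on {0..pi / 2} f" unfolding f_def by (intro continuous_intros)
    qed simp
    then obtain t where t: "f t = - p" by blast
    define C S where "C = cos t" and "S = sin t"
    have cs: "C * C + S * S = 1"
      using sin_cos_squared_add[of t] by (simp add: C_def S_def power2_eq_square)
    define x x' y y' where "x = \<alpha> * C" and "x' = - (\<alpha> * S)"
      and "y = \<beta> * C + \<gamma> * S" and "y' = \<gamma> * C - \<beta> * S"
    have "x\<^sup>2 + x'\<^sup>2 = \<alpha>\<^sup>2 * (C * C + S * S)"
      by (simp add: x_def x'_def algebra_simps power2_eq_square)
    then have xx: "x\<^sup>2 + x'\<^sup>2 = \<alpha>\<^sup>2" using cs by simp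
    have "y\<^sup>2 + y'\<^sup>2 = (\<beta>\<^sup>2 + \<gamma>\<^sup>2) * (C * C + S * S)"
      by (simp add: y_def y'_def algebra_simps power2_eq_square)
    then have yy: "y\<^sup>2 + y'\<^sup>2 = \<beta>\<^sup>2 + \<gamma>\<^sup>2" using cs by simp
    have "x * y + x' * y' = \<alpha> * \<beta> * (C * C + S * S)"
      by (simp add: x_def x'_def y_def y'_def algebra_simps)
    then have xy: "x * y + x' * y' = \<alpha> * \<beta>" using cs by simp
    have "x * y = - p" using t by (simp add: f_def x_def y_def C_def S_def)
    then show ?thesis
      using xx yy xy \<alpha> \<alpha>\<beta> \<gamma> assms by (intro that[of x x' y y']) auto
  qed
qed

text \<open>
  The vectors \<open>e\<close> and \<open>g\<close> are the images of \<open>p\<close> and \<open>q\<close>. The two factors of the target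
  space are the two planes: the components \<open>u1\<close>, \<open>u2\<close> orthogonal to \<open>p\<close> and \<open>q\<close> are
  distributed over them so that the plane of \<open>p\<close> receives \<open>(a1, x1)\<close>, \<open>(a2, x2)\<close> and the
  plane of \<open>q\<close> receives \<open>(b1, y1)\<close>, \<open>(b2, y2)\<close>. The hypothesis of
  \<open>split_inner_product\<close> is \<open>inner v1 v2 \<ge> 0\<close>, because
  \<open>inner v1 v2 = a1 a2 + b1 b2 + inner u1 u2\<close>.
\<close>

lemma orthant_embedding_orthogonal_pair:
  fixes v1 v2 p q :: "'a::real_inner"
  assumes "inner p q = 0" and "0 \<le> inner v1 v2"
    and "0 \<le> inner v1 p" "0 \<le> inner v2 p" "0 \<le> inner v1 q" "0 \<le> inner v2 q"
  obtains w1 w2 e g :: "(real \<times> real) \<times> (real \<times> real)"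
  where "0 \<le> w1" "0 \<le> w2" "0 \<le> e" "0 \<le> g"
    and "inner w1 w1 = inner v1 v1" "inner w2 w2 = inner v2 v2" "inner w1 w2 = inner v1 v2"
    and "inner w1 e = inner v1 p" "inner w2 e = inner v2 p"
    and "inner w1 g = inner v1 q" "inner w2 g = inner v2 q"
    and "inner e e = inner p p" "inner g g = inner q q" "inner e g = 0"
proof -
  define p' q' where "p' = sgn p" and "q' = sgn q"
  define a1 a2 b1 b2 where "a1 = inner v1 p'" and "a2 = inner v2 p'"
    and "b1 = inner v1 q'" and "b2 = inner v2 q'"
  have scale: "inner x p = norm p * inner x p'" "inner x q = norm q * inner x q'" for x
    by (cases "p = 0"; simp add: p'_def sgn_div_norm) (cases "q = 0"; simp add: q'_def sgn_div_norm)
  have nonneg: "0 \<le> a1" "0 \<le> a2" "0 \<le> b1" "0 \<le> b2"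
    using assms by (auto simp: a1_def a2_def b1_def b2_def p'_def q'_def sgn_div_norm)
  have orth: "inner p' q' = 0"
    using assms(1) by (simp add: p'_def q'_def sgn_div_norm)
  define u1 u2 where "u1 = v1 - a1 *\<^sub>R p' - b1 *\<^sub>R q'" and "u2 = v2 - a2 *\<^sub>R p' - b2 *\<^sub>R q'"
  (* p' is a unit vector or zero; in both cases projecting to it is idempotent. *)
  have unit: "inner x p' * inner p' p' = inner x p'" "inner x q' * inner q' q' = inner x q'" for x
    by (cases "p = 0"; simp add: p'_def dot_square_norm norm_sgn)
      (cases "q = 0"; simp add: q'_def dot_square_norm norm_sgn)
  have gram: "inner (x - inner x p' *\<^sub>R p' - inner x q' *\<^sub>R q') (y - inner y p' *\<^sub>R p' - inner y q' *\<^sub>R q')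
      = inner x y - inner x p' * inner y p' - inner x q' * inner y q'" for x y
  proof -
    have "inner (x - inner x p' *\<^sub>R p' - inner x q' *\<^sub>R q') (y - inner y p' *\<^sub>R p' - inner y q' *\<^sub>R q')
      = inner x y - 2 * (inner x p' * inner y p') - 2 * (inner x q' * inner y q')
        + inner y p' * (inner x p' * inner p' p') + inner y q' * (inner x q' * inner q' q')"
      using orth by (simp add: inner_diff_left inner_diff_right inner_commute algebra_simps)
    then show ?thesis unfolding unit by (simp add: algebra_simps)
  qed
  have u: "inner u1 u1 = inner v1 v1 - a1\<^sup>2 - b1\<^sup>2" "inner u2 u2 = inner v2 v2 - a2\<^sup>2 - b2\<^sup>2"
    "inner u1 u2 = inner v1 v2 - a1 * a2 - b1 * b2"
    using gram[of v1 v1] gram[of v2 v2] gram[of v1 v2]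
    by (simp_all add: u1_def u2_def a1_def a2_def b1_def b2_def power2_eq_square)
  obtain x1 x2 y1 y2 where xy: "x1\<^sup>2 + y1\<^sup>2 = inner u1 u1" "x2\<^sup>2 + y2\<^sup>2 = inner u2 u2"
    "x1 * x2 + y1 * y2 = inner u1 u2" "0 \<le> a1 * a2 + x1 * x2" "0 \<le> b1 * b2 + y1 * y2"
    by (rule split_inner_product[of "a1 * a2" "b1 * b2" u1 u2])
      (use nonneg assms(2) u in auto)
  obtain e s1 s2 :: "real \<times> real" where s: "0 \<le> e" "0 \<le> s1" "0 \<le> s2"
    "inner e e = 1" "inner s1 e = a1" "inner s2 e = a2"
    "inner s1 s1 = a1\<^sup>2 + x1\<^sup>2" "inner s2 s2 = a2\<^sup>2 + x2\<^sup>2" "inner s1 s2 = a1 * a2 + x1 * x2"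
    using planar_quadrant nonneg(1,2) xy(4) by blast
  obtain g t1 t2 :: "real \<times> real" where t: "0 \<le> g" "0 \<le> t1" "0 \<le> t2"
    "inner g g = 1" "inner t1 g = b1" "inner t2 g = b2"
    "inner t1 t1 = b1\<^sup>2 + y1\<^sup>2" "inner t2 t2 = b2\<^sup>2 + y2\<^sup>2" "inner t1 t2 = b1 * b2 + y1 * y2"
    using planar_quadrant nonneg(3,4) xy(5) by blast
  have sq: "inner p p = norm p * norm p" "inner q q = norm q * norm q"
    by (simp_all add: dot_square_norm power2_eq_square)
  show ?thesis
  proof (rule that[of "(s1, t1)" "(s2, t2)" "(norm p *\<^sub>R e, 0)" "(0, norm q *\<^sub>R g)"])
    show "0 \<le> (norm p *\<^sub>R e, 0 :: real \<times> real)" "0 \<le> (0 :: real \<times> real, norm q *\<^sub>R g)"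
      using s(1) t(1) by (auto simp: less_eq_prod_def)
  qed (use s t xy u sq in \<open>auto simp: less_eq_prod_def scale a1_def a2_def b1_def b2_def\<close>)
qed


text \<open>
  In a pair with the largest angle, replace one vector by its component orthogonal to the other.
  Because the angle is largest, this component keeps a nonnegative inner product with the remaining
  two vectors, and the case of an orthogonal pair applies.
\<close>

lemma orthant_embedding_four:
  fixes f :: "'i \<Rightarrow> 'a::real_inner"
  assumes "card I = 4" and nonneg: "\<And>i j. i \<in> I \<Longrightarrow> j \<in> I \<Longrightarrow> 0 \<le> inner (f i) (f j)"
  obtains w :: "'i \<Rightarrow> (real \<times> real) \<times> (real \<times> real)"
  where "\<And>i. i \<in> I \<Longrightarrow> 0 \<le> w i"
    and "\<And>i j. i \<in> I \<Longrightarrow> j \<in> I \<Longrightarrow> inner (w i) (w j) = inner (f i) (f j)"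
proof -
  (* A zero vector stays zero; it then belongs to a pair with the smallest value, namely 0. *)
  define s where "s i = sgn (f i)" for i
  have fs: "inner (f i) (f j) = norm (f i) * norm (f j) * inner (s i) (s j)" for i j
  proof -
    have "f m = norm (f m) *\<^sub>R s m" for m by (cases "f m = 0") (simp_all add: s_def sgn_div_norm)
    then show ?thesis by (metis inner_scaleR_left inner_scaleR_right mult.assoc)
  qed
  have s_nonneg: "0 \<le> inner (s i) (s j)" if "i \<in> I" "j \<in> I" for i j
    using nonneg[OF that] by (simp add: s_def sgn_div_norm)
  have s_le1: "inner (s i) (s j) \<le> 1" for i j
  proof -
    have "inner (s i) (s j) \<le> norm (s i) * norm (s j)" by (rule norm_cauchy_schwarz)
    also have "\<dots> \<le> 1" by (simp add: s_def norm_sgn)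
    finally show ?thesis .
  qed
  define Q where "Q = {(k, l). k \<in> I \<and> l \<in> I \<and> k \<noteq> l}"
  have "finite I" using assms(1) by (metis card.infinite zero_neq_numeral)
  then have finQ: "finite Q"
    by (intro finite_subset[of Q "I \<times> I"]) (auto simp: Q_def)
  have "\<not> is_singleton I" "I \<noteq> {}" using assms(1) by (auto simp: is_singleton_altdef)
  then have neQ: "Q \<noteq> {}" unfolding Q_def is_singleton_def by blast
  define h where "h = (\<lambda>(k, l). inner (s k) (s l))"
  obtain k l where kl_eq: "arg_min_on h Q = (k, l)" by force
  have "(k, l) \<in> Q" using arg_min_if_finite(1)[OF finQ neQ, of h] kl_eq by simp
  then have kl: "k \<in> I" "l \<in> I" "k \<noteq> l" by (simp_all add: Q_def)
  have least: "inner (s k) (s l) \<le> inner (s i) (s j)" if "i \<in> I" "j \<in> I" "i \<noteq> j" for i j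
    using arg_min_least[OF finQ neQ, of "(i, j)" h] that kl_eq by (simp add: Q_def h_def)
  have "card (I - {k, l}) = 2" using kl assms(1) \<open>finite I\<close> by (simp add: card_Diff_subset)
  then obtain i j where ij: "I - {k, l} = {i, j}" "i \<noteq> j" by (auto simp: card_2_iff)
  then have I: "I = {i, j, k, l}" and ne: "i \<noteq> k" "i \<noteq> l" "j \<noteq> k" "j \<noteq> l" using kl by blast+
  define c where "c = inner (s k) (s l)"
  define q where "q = s l - c *\<^sub>R s k"
  have "c * inner (s k) (s k) = c"
    by (cases "f k = 0") (auto simp: c_def s_def dot_square_norm norm_sgn)
  then have orth: "inner (s k) q = 0" by (simp add: q_def inner_diff_right c_def)
  have c0: "0 \<le> c" using s_nonneg kl by (simp add: c_def)
  have q_nonneg: "0 \<le> inner (s m) q" if "m \<in> {i, j}" for m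
  proof -
    have "m \<in> I" "m \<noteq> l" using that I ne by auto
    have "c * inner (s m) (s k) \<le> c" using c0 s_le1[of m k] by (simp add: mult_left_le)
    also have "c \<le> inner (s m) (s l)" using least kl \<open>m \<in> I\<close> \<open>m \<noteq> l\<close> unfolding c_def by blast
    finally show ?thesis by (simp add: q_def inner_diff_right)
  qed
  obtain wi wj e g :: "(real \<times> real) \<times> (real \<times> real)"
    where w0: "0 \<le> wi" "0 \<le> wj" "0 \<le> e" "0 \<le> g"
    and w: "inner wi wi = inner (s i) (s i)" "inner wj wj = inner (s j) (s j)"
    "inner wi wj = inner (s i) (s j)"
    "inner wi e = inner (s i) (s k)" "inner wj e = inner (s j) (s k)"
    "inner wi g = inner (s i) q" "inner wj g = inner (s j) q"
    "inner e e = inner (s k) (s k)" "inner g g = inner q q" "inner e g = 0"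
    by (rule orthant_embedding_orthogonal_pair[of "s k" q "s i" "s j"])
      (use orth s_nonneg q_nonneg I in auto)
  define u where "u m = (if m = i then wi else if m = j then wj else if m = k then e else g + c *\<^sub>R e)" for m
  have u: "u i = wi" "u j = wj" "u k = e" "u l = g + c *\<^sub>R e" using ne ij(2) kl(3) by (auto simp: u_def)
  have sl: "s l = q + c *\<^sub>R s k" by (simp add: q_def)
  have u_gram: "inner (u m) (u m') = inner (s m) (s m')" if "m \<in> I" "m' \<in> I" for m m'
    using that w orth unfolding I
    by (auto simp: u sl inner_add_left inner_add_right inner_commute)
  have u0: "0 \<le> u m" if "m \<in> I" for m
    using that w0 c0 unfolding I by (auto simp: u less_eq_prod_def)
  show ?thesis
  proof (rule that[of "\<lambda>m. norm (f m) *\<^sub>R u m"])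
    show "0 \<le> norm (f m) *\<^sub>R u m" if "m \<in> I" for m
      using u0[OF that] by (auto simp: less_eq_prod_def)
  qed (simp add: u_gram fs)
qed

text \<open>
  Add a unit vector orthogonal to the given vectors and move all four into the four-dimensional
  orthant. Some coordinate of the image of the added vector is positive. Nonnegative vectors are
  orthogonal only if their supports are disjoint, so this coordinate vanishes on the images of the
  given vectors and can be dropped.
\<close>

lemma orthant_embedding_three:
  fixes f :: "'i \<Rightarrow> 'a::real_inner"
  assumes "card I = 3" and nonneg: "\<And>i j. i \<in> I \<Longrightarrow> j \<in> I \<Longrightarrow> 0 \<le> inner (f i) (f j)"
  obtains w :: "'i \<Rightarrow> (real \<times> real) \<times> real"
  where "\<And>i. i \<in> I \<Longrightarrow> 0 \<le> w i"
    and "\<And>i j. i \<in> I \<Longrightarrow> j \<in> I \<Longrightarrow> inner (w i) (w j) = inner (f i) (f j)"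
proof -
  define I' where "I' = insert None (Some ` I)"
  define F where "F m = (case m of None \<Rightarrow> (0, 1) | Some i \<Rightarrow> (f i, 0 :: real))" for m
  have "finite I" using assms(1) by (metis card.infinite zero_neq_numeral)
  then have "card I' = 4" unfolding I'_def using assms(1)
    by (subst card_insert_disjoint) (auto simp: card_image)
  moreover have "0 \<le> inner (F m) (F m')" if "m \<in> I'" "m' \<in> I'" for m m'
    using that nonneg by (auto simp: F_def I'_def)
  ultimately obtain w :: "'i option \<Rightarrow> (real \<times> real) \<times> (real \<times> real)"
    where w0: "\<And>i. i \<in> I' \<Longrightarrow> 0 \<le> w i"
      and w: "\<And>i j. i \<in> I' \<Longrightarrow> j \<in> I' \<Longrightarrow> inner (w i) (w j) = inner (F i) (F j)"
    by (rule orthant_embedding_four[of I' F]) auto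
  obtain a b c d where n: "w None = ((a, b), (c, d))" by (metis prod.exhaust)
  have abcd: "0 \<le> a" "0 \<le> b" "0 \<le> c" "0 \<le> d" "a * a + b * b + (c * c + d * d) = 1"
    using w0[of None] w[of None None] by (auto simp: n I'_def F_def less_eq_prod_def)
  define x1 x2 x3 x4 where "x1 i = fst (fst (w (Some i)))" and "x2 i = snd (fst (w (Some i)))"
    and "x3 i = fst (snd (w (Some i)))" and "x4 i = snd (snd (w (Some i)))" for i
  have wi: "w (Some i) = ((x1 i, x2 i), (x3 i, x4 i))" for i
    by (simp add: x1_def x2_def x3_def x4_def)
  have pos: "0 \<le> x1 i" "0 \<le> x2 i" "0 \<le> x3 i" "0 \<le> x4 i" if "i \<in> I" for i
    using w0[of "Some i"] that by (auto simp: wi I'_def less_eq_prod_def)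
  have gram: "x1 i * x1 j + (x2 i * x2 j + (x3 i * x3 j + x4 i * x4 j)) = inner (f i) (f j)"
    if "i \<in> I" "j \<in> I" for i j
    using w[of "Some i" "Some j"] that by (auto simp: wi I'_def F_def add.assoc)
  have zero: "a * x1 i = 0 \<and> b * x2 i = 0 \<and> c * x3 i = 0 \<and> d * x4 i = 0" if "i \<in> I" for i
  proof -
    have "a * x1 i + b * x2 i + (c * x3 i + d * x4 i) = 0"
      using w[of None "Some i"] that by (auto simp: wi n I'_def F_def)
    moreover have "0 \<le> a * x1 i" "0 \<le> b * x2 i" "0 \<le> c * x3 i" "0 \<le> d * x4 i"
      using abcd pos[OF that] by simp_all
    ultimately show ?thesis by linarith
  qed
  consider "a \<noteq> 0" | "b \<noteq> 0" | "c \<noteq> 0" | "d \<noteq> 0" using abcd(5) by fastforce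
  then show ?thesis
  proof cases
    case 1
    then have "x1 i = 0" if "i \<in> I" for i using zero[OF that] by simp
    then show ?thesis using pos gram
      by (intro that[of "\<lambda>i. ((x2 i, x3 i), x4 i)"]) (auto simp: less_eq_prod_def add.assoc)
  next
    case 2
    then have "x2 i = 0" if "i \<in> I" for i using zero[OF that] by simp
    then show ?thesis using pos gram
      by (intro that[of "\<lambda>i. ((x1 i, x3 i), x4 i)"]) (auto simp: less_eq_prod_def add.assoc)
  next
    case 3
    then have "x3 i = 0" if "i \<in> I" for i using zero[OF that] by simp
    then show ?thesis using pos gram
      by (intro that[of "\<lambda>i. ((x1 i, x2 i), x4 i)"]) (auto simp: less_eq_prod_def add.assoc)
  next
    case 4
    then have "x4 i = 0" if "i \<in> I" for i using zero[OF that] by simp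
    then show ?thesis using pos gram
      by (intro that[of "\<lambda>i. ((x1 i, x2 i), x3 i)"]) (auto simp: less_eq_prod_def add.assoc)
  qed
qed

section \<open>Square nonnegative factors of Gram matrices\<close>

lemma gram_entry:
  assumes "B \<in> carrier_mat r n" "i < n" "j < n"
  shows "(B\<^sup>T * B) $$ (i, j) = (\<Sum>k<r. B $$ (k, i) * B $$ (k, j))"
  using assms by (simp add: scalar_prod_def atLeast0LessThan)

lemma nonneg_gram_factor_3:
  assumes B: "B \<in> carrier_mat 3 3" and nonneg: "entrywise_nonneg (B\<^sup>T * B)"
  obtains N where "N \<in> carrier_mat 3 3" "entrywise_nonneg N" "N\<^sup>T * N = B\<^sup>T * B"
proof -
  define f where "f i = ((B $$ (0, i), B $$ (1, i)), B $$ (2, i))" for i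
  have sum3: "(\<Sum>k<3. h k) = h 0 + h 1 + h 2" for h :: "nat \<Rightarrow> real"
    by (simp add: eval_nat_numeral)
  have f: "(B\<^sup>T * B) $$ (i, j) = inner (f i) (f j)" if "i < 3" "j < 3" for i j
    using gram_entry[OF B that] by (simp add: f_def sum3)
  obtain w :: "nat \<Rightarrow> (real \<times> real) \<times> real"
    where w0: "\<And>i. i \<in> {..<3} \<Longrightarrow> 0 \<le> w i"
      and w: "\<And>i j. i \<in> {..<3} \<Longrightarrow> j \<in> {..<3} \<Longrightarrow> inner (w i) (w j) = inner (f i) (f j)"
    by (rule orthant_embedding_three[of "{..<3}" f])
      (use nonneg B in \<open>auto simp: entrywise_nonneg_def f[symmetric] simp del: index_mult_mat(1)\<close>)
  define N where "N = mat 3 3 (\<lambda>(k, i). [fst (fst (w i)), snd (fst (w i)), snd (w i)] ! k)"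
  have N: "N \<in> carrier_mat 3 3" by (simp add: N_def)
  show ?thesis
  proof (rule that[OF N])
    show "entrywise_nonneg N"
      using w0 by (auto simp: entrywise_nonneg_def N_def less_eq_prod_def less_Suc_eq eval_nat_numeral)
    show "N\<^sup>T * N = B\<^sup>T * B"
    proof (rule eq_matI)
      fix i j assume "i < dim_row (B\<^sup>T * B)" "j < dim_col (B\<^sup>T * B)"
      then have ij: "i < 3" "j < 3" using B by auto
      have "(N\<^sup>T * N) $$ (i, j) = inner (w i) (w j)"
        using gram_entry[OF N ij] ij by (simp add: sum3 N_def inner_prod_def)
      then show "(N\<^sup>T * N) $$ (i, j) = (B\<^sup>T * B) $$ (i, j)" using w f ij by simp
    qed (use N B in auto)
  qed
qed

lemma nonneg_gram_factor_4:
  assumes B: "B \<in> carrier_mat 4 4" and nonneg: "entrywise_nonneg (B\<^sup>T * B)"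
  obtains N where "N \<in> carrier_mat 4 4" "entrywise_nonneg N" "N\<^sup>T * N = B\<^sup>T * B"
proof -
  define f where "f i = ((B $$ (0, i), B $$ (1, i)), (B $$ (2, i), B $$ (3, i)))" for i
  have sum4: "(\<Sum>k<4. h k) = h 0 + h 1 + (h 2 + h 3)" for h :: "nat \<Rightarrow> real"
    by (simp add: eval_nat_numeral)
  have f: "(B\<^sup>T * B) $$ (i, j) = inner (f i) (f j)" if "i < 4" "j < 4" for i j
    using gram_entry[OF B that] by (simp add: f_def sum4)
  obtain w :: "nat \<Rightarrow> (real \<times> real) \<times> (real \<times> real)"
    where w0: "\<And>i. i \<in> {..<4} \<Longrightarrow> 0 \<le> w i"
      and w: "\<And>i j. i \<in> {..<4} \<Longrightarrow> j \<in> {..<4} \<Longrightarrow> inner (w i) (w j) = inner (f i) (f j)"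
    by (rule orthant_embedding_four[of "{..<4}" f])
      (use nonneg B in \<open>auto simp: entrywise_nonneg_def f[symmetric] simp del: index_mult_mat(1)\<close>)
  define N where "N = mat 4 4 (\<lambda>(k, i).
    [fst (fst (w i)), snd (fst (w i)), fst (snd (w i)), snd (snd (w i))] ! k)"
  have N: "N \<in> carrier_mat 4 4" by (simp add: N_def)
  show ?thesis
  proof (rule that[OF N])
    show "entrywise_nonneg N"
      using w0 by (auto simp: entrywise_nonneg_def N_def less_eq_prod_def less_Suc_eq eval_nat_numeral)
    show "N\<^sup>T * N = B\<^sup>T * B"
    proof (rule eq_matI)
      fix i j assume "i < dim_row (B\<^sup>T * B)" "j < dim_col (B\<^sup>T * B)"
      then have ij: "i < 4" "j < 4" using B by auto
      have "(N\<^sup>T * N) $$ (i, j) = inner (w i) (w j)"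
        using gram_entry[OF N ij] ij by (simp add: sum4 N_def inner_prod_def)
      then show "(N\<^sup>T * N) $$ (i, j) = (B\<^sup>T * B) $$ (i, j)" using w f ij by simp
    qed (use N B in auto)
  qed
qed

section \<open>Rank and cp-rank\<close>

text \<open>The columns of \<open>A * B\<close> lie in the column space of \<open>A\<close>.\<close>

lemma rank_mult_le_left:
  fixes A B :: "real mat"
  assumes A: "A \<in> carrier_mat n m" and B: "B \<in> carrier_mat m k"
  shows "vec_space.rank n (A * B) \<le> vec_space.rank n A"
proof -
  interpret vec_space "TYPE(real)" n .
  let ?W = "span (set (cols A))"
  have colsA: "set (cols A) \<subseteq> carrier_vec n" using A cols_dim by blast
  have sub: "set (cols (A * B)) \<subseteq> ?W"
  proof
    fix v assume "v \<in> set (cols (A * B))"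
    then obtain c where c: "c < k" "v = col (A * B) c"
      using A B by (metis carrier_matD(2) cols_length cols_nth in_set_conv_nth index_mult_mat(3))
    have "v = A *\<^sub>v col B c" using c A B by auto
    then show "v \<in> ?W"
      using col_space_eq[OF A] c A B unfolding col_space_def by auto
  qed
  have vs: "vectorspace class_ring (vs ?W)"
    using span_is_subspace[THEN subspace_is_vs, OF colsA] .
  have submod: "submodule class_ring ?W V" using colsA by (simp add: span_is_submodule)
  have "VectorSpace.subspace class_ring (span (set (cols (A * B)))) (vs ?W)"
    using vectorspace.span_is_subspace[OF vs, of "set (cols (A * B))",
      unfolded span_li_not_depend(1)[OF sub submod]] sub by auto
  moreover have "vectorspace.fin_dim class_ring (vs ?W)"
    "vectorspace.fin_dim class_ring (vs ?W\<lparr>carrier := span (set (cols (A * B)))\<rparr>)"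
    using fin_dim_span_cols A mult_carrier_mat[OF A B] by auto
  ultimately show ?thesis
    unfolding rank_def using vectorspace.subspace_dim[OF vs] by simp
qed

lemma rank_le_cp_factorization:
  assumes "cp_factorization m n A B"
  shows "mat_rank A \<le> m"
proof -
  have B: "B \<in> carrier_mat m n" "A = B\<^sup>T * B" using assms by (auto simp: cp_factorization_def)
  have T: "B\<^sup>T \<in> carrier_mat n m" using B by simp
  have "vec_space.rank n A \<le> vec_space.rank n (B\<^sup>T)"
    using rank_mult_le_left[OF T B(1)] B(2) by simp
  also have "\<dots> \<le> m" by (rule vec_space.rank_le_nc[OF T])
  finally show ?thesis using B by simp
qed

lemma CP_if_rank_many_rows:
  assumes "cp_factorization r n A M" and "mat_rank A = r"
  shows "A \<in> CP n r"
proof -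
  have "cp_rank n A = r" unfolding cp_rank_def
    by (rule Least_equality) (use assms rank_le_cp_factorization in blast)+
  moreover have "completely_positive n A"
    using assms(1) by (auto simp: completely_positive_def cp_factorization_def)
  ultimately show ?thesis using assms(2) by (simp add: CP_def)
qed

section \<open>Nonnegative equivalent factors\<close>

lemma entrywise_nonneg_mult:
  assumes "entrywise_nonneg M" "entrywise_nonneg D" "dim_col M = dim_row D"
  shows "entrywise_nonneg (M * D)"
  using assms by (auto simp: entrywise_nonneg_def scalar_prod_def intro!: sum_nonneg)

text \<open>
  The factor \<open>B\<close> is nonnegative in the basis formed by \<open>r\<close> of its own columns, which reduces
  the question to the Gram matrix of these columns. This holds for each order \<open>r\<close> in which
  nonnegative Gram matrices have square nonnegative factors.
\<close>

lemma CP_if_nnq: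
  assumes A: "A \<in> DN n r" and B: "B \<in> carrier_mat r n" and AB: "A = B\<^sup>T * B" and "nnq r n B"
    and factor: "\<And>B\<^sub>1. B\<^sub>1 \<in> carrier_mat r r \<Longrightarrow> entrywise_nonneg (B\<^sub>1\<^sup>T * B\<^sub>1) \<Longrightarrow>
      \<exists>N \<in> carrier_mat r r. entrywise_nonneg N \<and> N\<^sup>T * N = B\<^sub>1\<^sup>T * B\<^sub>1"
  shows "A \<in> CP n r"
proof -
  obtain J C where J: "J \<subseteq> {..<n}" "card J = r" and C: "C \<in> carrier_mat r r"
    and inv: "inverts_mat (submatrix B UNIV J) C" and CB: "entrywise_nonneg (C * B)"
    using assms(4) unfolding nnq_def Let_def by blast
  define B\<^sub>1 where "B\<^sub>1 = submatrix B UNIV J"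
  have J': "{j. j < n \<and> j \<in> J} = J" using J(1) by auto
  have B1: "B\<^sub>1 \<in> carrier_mat r r"
    using B J J' by (auto simp: B\<^sub>1_def dim_submatrix)
  have B1_entry: "B\<^sub>1 $$ (i, j) = B $$ (i, pick J j)" if "i < r" "j < r" for i j
    using that B J J' submatrix_index[of i B UNIV j J] by (simp add: B\<^sub>1_def pick_UNIV)
  have pick: "pick J i < n" if "i < r" for i
    using pick_in_set_le[of i J] that J by auto
  have "(B\<^sub>1\<^sup>T * B\<^sub>1) $$ (i, j) = A $$ (pick J i, pick J j)" if "i < r" "j < r" for i j
    unfolding AB gram_entry[OF B1 that] gram_entry[OF B pick[OF that(1)] pick[OF that(2)]]
    using that by (simp add: B1_entry)
  moreover have "entrywise_nonneg A" using A by (simp add: DN_def)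
  ultimately have "entrywise_nonneg (B\<^sub>1\<^sup>T * B\<^sub>1)"
    using B1 pick B AB by (auto simp: entrywise_nonneg_def simp del: index_mult_mat(1))
  then obtain N where N: "N \<in> carrier_mat r r" "entrywise_nonneg N" "N\<^sup>T * N = B\<^sub>1\<^sup>T * B\<^sub>1"
    using factor[OF B1] by blast
  define D where "D = C * B"
  have D: "D \<in> carrier_mat r n" using C B by (simp add: D_def)
  have "B\<^sub>1 * C = 1\<^sub>m r" using inv B1 by (simp add: inverts_mat_def B\<^sub>1_def)
  then have "B = B\<^sub>1 * D"
    unfolding D_def using assoc_mult_mat[OF B1 C B] B by simp
  then have "A = (D\<^sup>T * B\<^sub>1\<^sup>T) * (B\<^sub>1 * D)" using AB transpose_mult[OF B1 D] by simp
  also have "\<dots> = D\<^sup>T * (B\<^sub>1\<^sup>T * B\<^sub>1) * D"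
    using B1 D by (simp add: assoc_mult_mat[of _ n r _ r _ n] assoc_mult_mat[of _ r r _ r _ n] assoc_mult_mat[of _ n r _ r _ r])
  also have "\<dots> = (D\<^sup>T * N\<^sup>T) * (N * D)"
    unfolding N(3)[symmetric]
    using N(1) D by (simp add: assoc_mult_mat[of _ n r _ r _ n] assoc_mult_mat[of _ r r _ r _ n] assoc_mult_mat[of _ n r _ r _ r])
  also have "\<dots> = (N * D)\<^sup>T * (N * D)" using transpose_mult[OF N(1) D] by simp
  finally have "cp_factorization r n A (N * D)"
    using entrywise_nonneg_mult[of N D] N D CB by (auto simp: cp_factorization_def D_def)
  then show ?thesis using A by (intro CP_if_rank_many_rows) (auto simp: DN_def)
qed

theorem theorem3p5:
  fixes n r :: nat and A B :: "real mat"
  assumes "0 < r" and "r \<le> n"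
    and "A \<in> DN n r"
    and "B \<in> carrier_mat r n" and "mat_rank B = r"
    and "A = B\<^sup>T * B"
  shows "(r = 3 \<and> nnq r n B \<longrightarrow> A \<in> CP n 3) \<and>
         (r = 4 \<and> nnq r n B \<longrightarrow> A \<in> CP n 4)"
proof (intro conjI impI)
  assume "r = 3 \<and> nnq r n B"
  then show "A \<in> CP n 3" using assms(3,4,6) CP_if_nnq[of A n 3 B] by (metis nonneg_gram_factor_3)
next
  assume "r = 4 \<and> nnq r n B"
  then show "A \<in> CP n 4" using assms(3,4,6) CP_if_nnq[of A n 4 B] by (metis nonneg_gram_factor_4)
qed

end
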